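(* Assume that the state constraint is of first order, i.e. $g'(\hat x_t)f_1(\hat x_t)\neq0$ whenever $g(\hat x_t)=0$. If the control $\hat u$ has a jump at a time $\tau\in(0,T)$ for which $g(\hat x_\tau)=0$, then $\mu$ is continuous at $\tau$ for any associated multiplier $(\beta,\Psi,p,\mathrm d\mu)\in\Lambda$.
   Context: Setting. $T>0$; $f_0,f_1:\mathbb R^n\to\mathbb R^n$ are $C^2$ and Lipschitz continuous; $\phi:\mathbb R^n\times\mathbb R^n\to\mathbb R$, $g:\mathbb R^n\to\mathbb R$ and $\Phi:\mathbb R^n\times\mathbb R^n\to\mathbb R^{n_1+n_2}$ are $C^2$; $u_{\min}\in\mathbb R\cup\{-\infty\}$, $u_{\max}\in\mathbb R\cup\{+\infty\}$. Set $f(u,x):=f_0(x)+uf_1(x)$ and $K_\Phi:=\{0\}_{\mathbb R^{n_1}}\times\mathbb R^{n_2}_-$. Problem (P): minimize $\phi(x_0,x_T)$ over $(u,x)\in L^\infty(0,T)\times W^{1,\infty}(0,T)^n$ subject to $\dot x_t=f_0(x_t)+u_tf_1(x_t)$ for a.a. $t$; $\Phi(x_0,x_T)\in K_\Phi$; $u_{\min}\le u_t\le u_{\max}$ for a.a. $t$; $g(x_t)\le 0$ for all $t\in[0,T]$. A pair satisfying all constraints is a feasible trajectory; $(\hat u,\hat x)$ is a fixed feasible trajectory. Multipliers. $\mathcal M$ is the space of finite Radon measures on $[0,T]$; every $\mathrm d\mu\in\mathcal M$ is identified with the derivative of a function $\mu$ of bounded variation with $\mu_T=0$. Let $\ell^{\beta,\Psi}:=\beta\phi+\Psi\Phi$.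 $\Lambda=\Lambda(\hat u,\hat x)$ is the set of $(\beta,\Psi,p,\mathrm d\mu)\in\mathbb R_+\times\mathbb R^{(n_1+n_2)*}\times BV(0,T)^{n*}\times\mathcal M$ with $(\beta,\Psi,\mathrm d\mu)\ne0$ such that: $\Psi_i\ge0$ and $\Psi_i\Phi_i(\hat x_0,\hat x_T)=0$ for $i=n_1+1,\dots,n_1+n_2$; $\mathrm d\mu\ge0$ and $\int_0^Tg(\hat x_t)\,\mathrm d\mu_t=0$; $-\mathrm dp_t=p_tf_x(\hat u_t,\hat x_t)\,\mathrm dt+g'(\hat x_t)\,\mathrm d\mu_t$ on $[0,T]$ with $(-p_0,p_T)=D\ell^{\beta,\Psi}(\hat x_0,\hat x_T)$; and for a.a. $t$: $\hat u_t=u_{\min}$ if $u_{\min}>-\infty$ and $p_tf_1(\hat x_t)>0$, $\hat u_t=u_{\max}$ if $u_{\max}<+\infty$ and $p_tf_1(\hat x_t)<0$, $p_tf_1(\hat x_t)=0$ if $u_{\min}<\hat u_t<u_{\max}$. Jumps. "$\hat u$ has a jump at $\tau$" means that some representative of $\hat u$ has finite left and right limits at $\tau$ and $[\hat u_\tau]:=\hat u(\tau+)-\hat u(\tau-)\neq0$.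
   Formalization: In the definition of Λ, the control condition is completed by requiring p_t f_1(x̂_t) ≤ 0 a.e. if u_min = −∞ and p_t f_1(x̂_t) ≥ 0 a.e. if u_max = +∞; with only the three stated lines the claim fails when exactly one bound is infinite. *)

theory Defs
  imports "HOL-Analysis.Analysis"
begin

definition C2 :: "('a::real_normed_vector \<Rightarrow> 'b::real_normed_vector) \<Rightarrow> bool" where
  "C2 h \<longleftrightarrow> (\<exists>(h' :: 'a \<Rightarrow> 'a \<Rightarrow>\<^sub>L 'b) (h'' :: 'a \<Rightarrow> 'a \<Rightarrow>\<^sub>L 'a \<Rightarrow>\<^sub>L 'b).
     (\<forall>x. (h has_derivative blinfun_apply (h' x)) (at x)) \<and>
     (\<forall>x. (h' has_derivative blinfun_apply (h'' x)) (at x)) \<and>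
     continuous_on UNIV h'')"

(* The derivative g'(x), a row vector, as an element of real^'n; its action on a column
   vector is the inner product. *)
definition row_deriv :: "(real^'n \<Rightarrow> real) \<Rightarrow> real^'n \<Rightarrow> real^'n" where
  "row_deriv g x = (\<chi> i. frechet_derivative g (at x) (axis i 1))"

definition Linf :: "real \<Rightarrow> (real \<Rightarrow> real) set" where
  "Linf T = {u. u \<in> borel_measurable (lebesgue_on {0..T}) \<and>
                (\<exists>C. AE t in lebesgue_on {0..T}. \<bar>u t\<bar> \<le> C)}"

(* W^{1,infinity}(0,T), each class being represented by its Lipschitz continuous element. *)
definition W1inf :: "real \<Rightarrow> (real \<Rightarrow> 'a::real_normed_vector) set" where
  "W1inf T = {x. \<exists>L. L-lipschitz_on {0..T} x}"

definition BV :: "real \<Rightarrow> (real \<Rightarrow> 'a::real_normed_vector) set" where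
  "BV T = {h. \<exists>C. \<forall>N s. (\<forall>k\<le>N. s k \<in> {0..T}) \<and> (\<forall>k<N. s k \<le> s (Suc k)) \<longrightarrow>
                (\<Sum>k<N. norm (h (s (Suc k)) - h (s k))) \<le> C}"

(* The Borel measures d mu on [0,T] are finite and, being of type measure, nonnegative.
   mu is the function of bounded variation with derivative d mu and mu_T = 0, in its
   right-continuous representative on (0,T).  As usual for BV functions whose derivative is a
   measure on the closed interval, the endpoint values are the outer ones: mu_0 is the value
   before a possible atom at 0, and mu_T the value after a possible atom at T. *)
definition bv_primitive :: "real \<Rightarrow> real measure \<Rightarrow> real \<Rightarrow> real" where
  "bv_primitive T M t = - measure M (if t \<le> 0 then {0..T} else {t<..T})"

(* Phi has components Phi 1, ..., Phi (n1 + n2); the first n1 are equality constraints.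
   n1 and n2 may be 0. *)
definition feasible ::
  "real \<Rightarrow> (real^'n \<Rightarrow> real^'n) \<Rightarrow> (real^'n \<Rightarrow> real^'n) \<Rightarrow> (real^'n \<Rightarrow> real) \<Rightarrow>
   nat \<Rightarrow> nat \<Rightarrow> (nat \<Rightarrow> (real^'n) \<times> (real^'n) \<Rightarrow> real) \<Rightarrow> ereal \<Rightarrow> ereal \<Rightarrow>
   (real \<Rightarrow> real) \<Rightarrow> (real \<Rightarrow> real^'n) \<Rightarrow> bool" where
  "feasible T f0 f1 g n1 n2 \<Phi> umin umax u x \<longleftrightarrow>
     u \<in> Linf T \<and> x \<in> W1inf T \<and>
     (AE t in lebesgue_on {0..T}.
        (x has_vector_derivative (f0 (x t) + u t *\<^sub>R f1 (x t))) (at t)) \<and>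
     (\<forall>i\<in>{1..n1}. \<Phi> i (x 0, x T) = 0) \<and>
     (\<forall>i\<in>{n1+1..n1+n2}. \<Phi> i (x 0, x T) \<le> 0) \<and>
     (AE t in lebesgue_on {0..T}. umin \<le> ereal (u t) \<and> ereal (u t) \<le> umax) \<and>
     (\<forall>t\<in>{0..T}. g (x t) \<le> 0)"

definition endpoint_lagrangian ::
  "((real^'n) \<times> (real^'n) \<Rightarrow> real) \<Rightarrow> nat \<Rightarrow> (nat \<Rightarrow> (real^'n) \<times> (real^'n) \<Rightarrow> real) \<Rightarrow>
   real \<Rightarrow> (nat \<Rightarrow> real) \<Rightarrow> (real^'n) \<times> (real^'n) \<Rightarrow> real" where
  "endpoint_lagrangian \<phi> m \<Phi> \<beta> \<Psi> z = \<beta> * \<phi> z + (\<Sum>i=1..m. \<Psi> i * \<Phi> i z)"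

(* Integrated form of - dp = p f_x(u,x) dt + g'(x) d mu, an equality of measures on [0,T]:
   the measure dp gives [0,t] the mass p(t+) - p(0) for t < T and [0,T] the mass p(T) - p(0).
   As p is determined only up to a null set inside (0,T), the equation is imposed at T and
   at almost every t. *)
definition costate_eq ::
  "real \<Rightarrow> (real^'n \<Rightarrow> real^'n) \<Rightarrow> (real^'n \<Rightarrow> real^'n) \<Rightarrow> (real^'n \<Rightarrow> real) \<Rightarrow>
   (real \<Rightarrow> real) \<Rightarrow> (real \<Rightarrow> real^'n) \<Rightarrow> (real \<Rightarrow> real^'n) \<Rightarrow> real measure \<Rightarrow> bool" where
  "costate_eq T f0 f1 g u x p M \<longleftrightarrow>
     (let R = (\<lambda>t. (LINT s:{0..t}|lebesgue.
                      p s v* jacobian (\<lambda>y. f0 y + u s *\<^sub>R f1 y) (at (x s)))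
                   + (LINT s:{0..t}|M. row_deriv g (x s)))
      in (AE t in lebesgue_on {0..T}. - (p t - p 0) = R t) \<and> - (p T - p 0) = R T)"

(* With H = p_t f_1(x_t), the condition that v minimizes w |-> H w over the real numbers w
   with umin <= w <= umax.  The last two lines are what minimality requires on an unbounded
   side; they do not follow from the first three, which are vacuous for instance when
   umin = -infinity, v = umax and H > 0. *)
definition control_min_cond :: "ereal \<Rightarrow> ereal \<Rightarrow> real \<Rightarrow> real \<Rightarrow> bool" where
  "control_min_cond umin umax v H \<longleftrightarrow>
     (umin > -\<infinity> \<and> H > 0 \<longrightarrow> ereal v = umin) \<and>
     (umax < \<infinity> \<and> H < 0 \<longrightarrow> ereal v = umax) \<and>
     (umin < ereal v \<and> ereal v < umax \<longrightarrow> H = 0) \<and>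
     (umin = -\<infinity> \<longrightarrow> H \<le> 0) \<and>
     (umax = \<infinity> \<longrightarrow> H \<ge> 0)"

definition multipliers ::
  "real \<Rightarrow> (real^'n \<Rightarrow> real^'n) \<Rightarrow> (real^'n \<Rightarrow> real^'n) \<Rightarrow>
   ((real^'n) \<times> (real^'n) \<Rightarrow> real) \<Rightarrow> (real^'n \<Rightarrow> real) \<Rightarrow>
   nat \<Rightarrow> nat \<Rightarrow> (nat \<Rightarrow> (real^'n) \<times> (real^'n) \<Rightarrow> real) \<Rightarrow> ereal \<Rightarrow> ereal \<Rightarrow>
   (real \<Rightarrow> real) \<Rightarrow> (real \<Rightarrow> real^'n) \<Rightarrow>
   (real \<times> (nat \<Rightarrow> real) \<times> (real \<Rightarrow> real^'n) \<times> real measure) set" where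
  "multipliers T f0 f1 \<phi> g n1 n2 \<Phi> umin umax u x = {(\<beta>, \<Psi>, p, M).
     \<beta> \<ge> 0 \<and> p \<in> BV T \<and>
     finite_measure M \<and> sets M = sets (restrict_space borel {0..T}) \<and>
     (\<beta> \<noteq> 0 \<or> (\<exists>i\<in>{1..n1+n2}. \<Psi> i \<noteq> 0) \<or> emeasure M {0..T} \<noteq> 0) \<and>
     (\<forall>i\<in>{n1+1..n1+n2}. \<Psi> i \<ge> 0 \<and> \<Psi> i * \<Phi> i (x 0, x T) = 0) \<and>
     (LINT t|M. g (x t)) = 0 \<and>
     costate_eq T f0 f1 g u x p M \<and>
     (\<forall>a b. frechet_derivative (endpoint_lagrangian \<phi> (n1+n2) \<Phi> \<beta> \<Psi>) (at (x 0, x T)) (a, b)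
            = (- p 0) \<bullet> a + p T \<bullet> b) \<and>
     (AE t in lebesgue_on {0..T}. control_min_cond umin umax (u t) (p t \<bullet> f1 (x t)))}"

definition has_jump_at :: "real \<Rightarrow> (real \<Rightarrow> real) \<Rightarrow> real \<Rightarrow> bool" where
  "has_jump_at T u \<tau> \<longleftrightarrow>
     (\<exists>v l r. (AE t in lebesgue_on {0..T}. v t = u t) \<and>
        (v \<longlongrightarrow> l) (at_left \<tau>) \<and> (v \<longlongrightarrow> r) (at_right \<tau>) \<and> r - l \<noteq> 0)"

end

theory Submission
  imports Defs
begin

text \<open>
  Write \<open>G = g'(x \<tau>)\<close>, \<open>a = G f1(x \<tau>)\<close>, let \<open>l\<close>, \<open>r\<close> be the one-sided limits of the control
  at \<open>\<tau>\<close>, and let \<open>\<nu> \<ge> 0\<close> be the mass that the multiplier puts on \<open>{\<tau>}\<close>. The claim is \<open>\<nu> = 0\<close>, and it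
  comes from comparing two signs.

  First, \<open>t \<mapsto> g(x t)\<close> is maximal at \<open>\<tau>\<close>, where its value is \<open>0\<close>. Although the state equation holds
  only almost everywhere, \<open>x\<close> is Lipschitz, so its one-sided derivatives at \<open>\<tau>\<close> exist and are
  \<open>f0(x \<tau>) + l f1(x \<tau>)\<close> and \<open>f0(x \<tau>) + r f1(x \<tau>)\<close> (\<open>state_one_sided_derivatives\<close>). The left
  derivative of \<open>g(x t)\<close> is nonnegative and the right one nonpositive; subtracting gives
  \<open>(r - l) a \<le> 0\<close>, and this is strict because the constraint has first order.

  Second, in the costate equation the Lebesgue integral is continuous in \<open>t\<close>, so at \<open>\<tau>\<close> the costate
  jumps by \<open>- \<nu> G\<close> (\<open>costate_jump\<close>), and the switching function \<open>H = p f1(x)\<close> by \<open>- \<nu> a\<close>. If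
  \<open>l < r\<close>, the control is above \<open>umin\<close> just after \<open>\<tau>\<close> and below \<open>umax\<close> just before, so minimality
  of the control forces \<open>H\<close> to be nonpositive after and nonnegative before
  (\<open>control_min_cond_jump\<close>); the case \<open>r < l\<close> is the same with the two sides exchanged. Hence
  \<open>(r - l) (- \<nu> a) \<le> 0\<close>, which together with \<open>(r - l) a < 0\<close> leaves only \<open>\<nu> = 0\<close>.

  The control, the costate and the minimality condition are known only up to null sets. Their
  one-sided limits are therefore taken along filters that ignore null sets.
\<close>

section \<open>Essential one-sided limits\<close>

text \<open>
  Limits along this filter see \<open>S\<close> near \<open>\<tau>\<close> only up to Lebesgue null sets, so that a property
  holding almost everywhere holds eventually, and the limits do not depend on the choice of a
  representative.
\<close>

definition ess_at :: "real \<Rightarrow> real set \<Rightarrow> real filter" where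
  "ess_at \<tau> S = inf (at \<tau> within S) (ae_filter lebesgue)"

abbreviation "ess_left \<tau> \<equiv> ess_at \<tau> {..<\<tau>}"
abbreviation "ess_right \<tau> \<equiv> ess_at \<tau> {\<tau><..}"

lemma ess_at_le: "ess_at \<tau> S \<le> at \<tau> within S"
  by (simp add: ess_at_def)

lemma eventually_ess_at:
  assumes "AE t in lebesgue_on {a..b}. P t" and "a < \<tau>" and "\<tau> < b"
  shows "eventually P (ess_at \<tau> S)"
proof -
  have "eventually (\<lambda>t. t \<in> {a..b} \<longrightarrow> P t) (ae_filter lebesgue)"
    using assms(1) by (simp add: AE_restrict_space_iff)
  moreover have "eventually (\<lambda>t. t \<in> {a..b}) (at \<tau> within S)"
  proof -
    have "eventually (\<lambda>t. a < t) (at \<tau> within S)" "eventually (\<lambda>t. t < b) (at \<tau> within S)"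
      using order_tendstoD[OF tendsto_ident_at] assms(2,3) by blast+
    then show ?thesis by eventually_elim auto
  qed
  ultimately show ?thesis
    unfolding ess_at_def eventually_inf by (metis (mono_tags, lifting))
qed

text \<open>
  Order relations pass to limits only along a nontrivial filter; here this holds because no
  null set contains an interval.
\<close>

lemma ess_at_nontrivial:
  assumes "\<And>d. d > 0 \<Longrightarrow> \<exists>a b. a < b \<and> {a<..<b} \<subseteq> S \<inter> ball \<tau> d - {\<tau>}"
  shows "ess_at \<tau> S \<noteq> bot"
proof
  assume "ess_at \<tau> S = bot"
  then have "eventually (\<lambda>t. False) (ess_at \<tau> S)" by simp
  then obtain P Q where P: "eventually P (at \<tau> within S)" and Q: "eventually Q (ae_filter lebesgue)"
    and PQ: "\<And>t. \<not> (P t \<and> Q t)"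
    unfolding ess_at_def eventually_inf by auto
  obtain d where d: "d > 0" "\<And>t. t \<in> S \<Longrightarrow> t \<noteq> \<tau> \<Longrightarrow> dist t \<tau> < d \<Longrightarrow> P t"
    using P unfolding eventually_at by blast
  obtain N where N: "N \<in> null_sets lebesgue" "{t. \<not> Q t} \<subseteq> N"
    using Q unfolding eventually_ae_filter by auto
  obtain a b where ab: "a < b" "{a<..<b} \<subseteq> S \<inter> ball \<tau> d - {\<tau>}"
    using assms[OF d(1)] by blast
  have "P t" if "t \<in> {a<..<b}" for t
    using d(2)[of t] subsetD[OF ab(2) that] by (auto simp: dist_commute)
  then have "{a<..<b} \<subseteq> N" using N(2) PQ by blast
  then have "emeasure lebesgue {a<..<b} \<le> emeasure lebesgue N"
    using N(1) by (intro emeasure_mono) auto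
  then show False using N(1) ab(1) by (simp add: null_sets_def)
qed

lemma ess_left_nontrivial: "ess_left \<tau> \<noteq> bot"
proof (rule ess_at_nontrivial)
  fix d :: real assume "d > 0"
  then show "\<exists>a b. a < b \<and> {a<..<b} \<subseteq> {..<\<tau>} \<inter> ball \<tau> d - {\<tau>}"
    by (intro exI[of _ "\<tau> - d"] exI[of _ \<tau>]) (auto simp: dist_real_def)
qed

lemma ess_right_nontrivial: "ess_right \<tau> \<noteq> bot"
proof (rule ess_at_nontrivial)
  fix d :: real assume "d > 0"
  then show "\<exists>a b. a < b \<and> {a<..<b} \<subseteq> {\<tau><..} \<inter> ball \<tau> d - {\<tau>}"
    by (intro exI[of _ \<tau>] exI[of _ "\<tau> + d"]) (auto simp: dist_real_def)
qed

section \<open>One-sided derivatives of Lipschitz functions\<close>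

text \<open>
  A mean value inequality with an exceptional null set \<open>N\<close>. Cover \<open>N\<close> by an open set \<open>U\<close> of measure
  at most \<open>e\<close>. Near a point outside \<open>N\<close> the increments of \<open>w\<close> are bounded by \<open>B + e\<close> times the
  length; near a point of \<open>N\<close> they are bounded by \<open>L\<close> times the length, all of which lies in \<open>U\<close>.
  So the bound \<open>(B + e) (t - s) + L \<bar>U \<inter> (s, t]\<bar>\<close>, which is additive in the interval, holds locally,
  hence globally by bisection. Its second term is at most \<open>L e\<close>.
\<close>

lemma lipschitz_ae_derivative_bound:
  fixes w :: "real \<Rightarrow> 'a::real_normed_vector"
  assumes ab: "a \<le> b" and B: "0 \<le> B" and lip: "L-lipschitz_on {a..b} w"
    and N: "N \<in> null_sets lebesgue"
    and der: "\<And>t. t \<in> {a..b} - N \<Longrightarrow> (w has_vector_derivative w' t) (at t within {a..b})"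
    and bound: "\<And>t. t \<in> {a..b} - N \<Longrightarrow> norm (w' t) \<le> B"
  shows "norm (w b - w a) \<le> B * (b - a)"
proof -
  have L: "0 \<le> L" using lip by (rule lipschitz_on_nonneg)
  have approx: "norm (w b - w a) \<le> (B + e) * (b - a) + L * e" if e: "e > 0" for e
  proof -
    obtain U where U: "open U" "N \<subseteq> U" "U - N \<in> lmeasurable" "emeasure lebesgue (U - N) < ennreal e"
      using sets_lebesgue_outer_open[OF _ e, of N] N by (auto simp: null_sets_def)
    have UN: "emeasure lebesgue U = emeasure lebesgue (U - N)"
      using N U(1) by (simp add: emeasure_Diff_null_set)
    have Um: "U \<in> lmeasurable"
      using UN U(3,4) U(1) by (auto simp: fmeasurable_def)
    have mU: "measure lebesgue U \<le> e"
      using UN U(4) e by (metis Sigma_Algebra.measure_def enn2real_leI less_imp_le)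
    \<comment> \<open>Half-open intervals make \<open>m\<close> exactly additive.\<close>
    define m where "m s t = measure lebesgue (U \<inter> {s<..t})" for s t
    \<comment> \<open>The bisection principle needs \<open>P\<close> also for intervals reaching beyond \<open>{a..b}\<close>, hence the guard.\<close>
    define P where "P s t \<longleftrightarrow> (s \<in> {a..b} \<and> t \<in> {a..b} \<and> s \<le> t \<longrightarrow>
        norm (w t - w s) \<le> (B + e) * (t - s) + L * m s t)" for s t
    have mlm: "U \<inter> {s<..t} \<in> lmeasurable" for s t
      using Um by (intro fmeasurable_Int_fmeasurable) auto
    have "P a b"
    proof (rule Bolzano[OF ab, of P])
      fix r s t assume P: "P r s" "P s t" "r \<le> s" "s \<le> t"
      have "m r t = m r s + m s t"
      proof -
        have "U \<inter> {r<..t} = (U \<inter> {r<..s}) \<union> (U \<inter> {s<..t})" using P by auto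
        moreover have "measure lebesgue ((U \<inter> {r<..s}) \<union> (U \<inter> {s<..t})) =
            measure lebesgue (U \<inter> {r<..s}) + measure lebesgue (U \<inter> {s<..t})"
          using mlm[of r s] mlm[of s t] by (intro measure_Union) (auto simp: fmeasurable_def)
        ultimately show ?thesis by (simp add: m_def)
      qed
      moreover have "norm (w t - w r) \<le> norm (w t - w s) + norm (w s - w r)"
        using norm_triangle_ineq[of "w t - w s" "w s - w r"] by simp
      ultimately show "P r t"
        using P unfolding P_def by (auto simp: algebra_simps)
    next
      fix x assume x: "a \<le> x" "x \<le> b"
      show "\<exists>d>0. \<forall>s t. s \<le> x \<and> x \<le> t \<and> t - s < d \<longrightarrow> P s t"
      proof (cases "x \<in> N")
        case True
        then obtain d where d: "d > 0" "ball x d \<subseteq> U" using U(1,2) openE by blast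
        have "P s t" if st: "s \<le> x" "x \<le> t" "t - s < d" for s t
          unfolding P_def
        proof safe
          assume "s \<in> {a..b}" "t \<in> {a..b}" "s \<le> t"
          moreover have "{s<..t} \<subseteq> U" using d(2) st by (auto simp: dist_real_def subset_iff)
          then have "m s t = t - s" using \<open>s \<le> t\<close> by (simp add: m_def Int_absorb1)
          moreover have "norm (w t - w s) \<le> L * (t - s)"
            using lipschitz_onD[OF lip, of t s] calculation by (simp add: dist_norm)
          moreover have "0 \<le> (B + e) * (t - s)"
            using B e \<open>s \<le> t\<close> by simp
          ultimately show "norm (w t - w s) \<le> (B + e) * (t - s) + L * m s t" by simp
        qed
        then show ?thesis using d(1) by blast
      next
        case False
        then have "(w has_vector_derivative w' x) (at x within {a..b})" and Bx: "norm (w' x) \<le> B"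
          using der bound x by auto
        then obtain d where d: "d > 0" "\<And>y. y \<in> {a..b} \<Longrightarrow> \<bar>y - x\<bar> < d \<Longrightarrow>
            norm (w y - w x - (y - x) *\<^sub>R w' x) \<le> e * \<bar>y - x\<bar>"
          using e unfolding has_vector_derivative_def has_derivative_within_alt by (metis real_norm_def)
        have near: "norm (w y - w x) \<le> (B + e) * \<bar>y - x\<bar>" if "y \<in> {a..b}" "\<bar>y - x\<bar> < d" for y
        proof -
          have "norm (w y - w x) \<le> norm (w y - w x - (y - x) *\<^sub>R w' x) + norm ((y - x) *\<^sub>R w' x)"
            using norm_triangle_ineq[of "w y - w x - (y - x) *\<^sub>R w' x" "(y - x) *\<^sub>R w' x"] by simp
          also have "\<dots> \<le> e * \<bar>y - x\<bar> + \<bar>y - x\<bar> * B"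
            using d(2)[OF that] Bx by (simp add: mult_left_mono add_mono)
          finally show ?thesis by (simp add: algebra_simps)
        qed
        have "P s t" if st: "s \<le> x" "x \<le> t" "t - s < d" for s t
          unfolding P_def
        proof safe
          assume "s \<in> {a..b}" "t \<in> {a..b}" "s \<le> t"
          then have "norm (w t - w x) \<le> (B + e) * (t - x)" "norm (w s - w x) \<le> (B + e) * (x - s)"
            using near[of t] near[of s] st by auto
          moreover have "norm (w t - w s) \<le> norm (w t - w x) + norm (w s - w x)"
            using norm_triangle_ineq4[of "w t - w x" "w s - w x"] by simp
          moreover have "0 \<le> L * m s t" using L by (simp add: m_def)
          ultimately show "norm (w t - w s) \<le> (B + e) * (t - s) + L * m s t"
            by (simp add: algebra_simps)
        qed
        then show ?thesis using d(1) by blast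
      qed
    qed
    then have "norm (w b - w a) \<le> (B + e) * (b - a) + L * m a b"
      using ab by (simp add: P_def)
    moreover have "m a b \<le> e"
      unfolding m_def using mU measure_mono_fmeasurable[of "U \<inter> {a<..b}" U lebesgue] Um mlm[of a b]
      by (auto simp: fmeasurable_def)
    ultimately show ?thesis using mult_left_mono[OF _ L, of "m a b" e] by linarith
  qed
  show ?thesis
  proof (rule field_le_epsilon)
    fix e :: real assume "e > 0"
    define e' where "e' = e / (b - a + L + 1)"
    have "e' > 0" using \<open>e > 0\<close> L ab by (simp add: e'_def)
    have "norm (w b - w a) \<le> B * (b - a) + e' * (b - a + L)"
      using approx[OF \<open>e' > 0\<close>] by (simp add: algebra_simps)
    also have "e' * (b - a + L) \<le> e' * (b - a + L + 1)" using \<open>e' > 0\<close> by simp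
    also have "\<dots> = e" using L ab by (simp add: e'_def)
    finally show "norm (w b - w a) \<le> B * (b - a) + e" by simp
  qed
qed

text \<open>
  For \<open>\<tau> = a\<close> or \<open>\<tau> = b\<close> this yields the one-sided derivatives. The reason: near \<open>\<tau>\<close> the function
  \<open>x t - t D\<close> has a derivative of norm at most \<open>e\<close> almost everywhere, hence is Lipschitz with
  constant \<open>e\<close> there.
\<close>

lemma one_sided_vector_derivative:
  fixes x :: "real \<Rightarrow> 'a::real_normed_vector"
  assumes lip: "L-lipschitz_on {a..b} x"
    and der: "AE t in lebesgue_on {a..b}. (x has_vector_derivative w t) (at t)"
    and lim: "(w \<longlongrightarrow> D) (ess_at \<tau> {a..b})"
    and \<tau>: "\<tau> \<in> {a..b}"
  shows "(x has_vector_derivative D) (at \<tau> within {a..b})"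
  unfolding has_vector_derivative_def has_derivative_within_alt
proof (intro conjI allI impI)
  show "bounded_linear (\<lambda>h. h *\<^sub>R D)" by (rule bounded_linear_scaleR_left)
next
  fix e :: real assume e: "e > 0"
  have "eventually (\<lambda>t. norm (w t - D) < e) (ess_at \<tau> {a..b})"
    using tendstoD[OF lim e] by (simp add: dist_norm)
  then obtain P Q where P: "eventually P (at \<tau> within {a..b})"
    and Q: "eventually Q (ae_filter lebesgue)" and PQ: "\<And>t. P t \<Longrightarrow> Q t \<Longrightarrow> norm (w t - D) < e"
    unfolding ess_at_def eventually_inf by auto
  obtain d where d: "d > 0" "\<And>t. t \<in> {a..b} \<Longrightarrow> t \<noteq> \<tau> \<Longrightarrow> dist t \<tau> < d \<Longrightarrow> P t"
    using P unfolding eventually_at by blast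
  have "eventually (\<lambda>t. Q t \<and> (t \<in> {a..b} \<longrightarrow> (x has_vector_derivative w t) (at t))) (ae_filter lebesgue)"
    using Q der by (simp add: AE_restrict_space_iff eventually_conj_iff)
  then obtain N0 where N0: "N0 \<in> null_sets lebesgue"
    "{t. \<not> (Q t \<and> (t \<in> {a..b} \<longrightarrow> (x has_vector_derivative w t) (at t)))} \<subseteq> N0"
    unfolding eventually_ae_filter by auto
  \<comment> \<open>The punctured limit says nothing about \<open>w \<tau>\<close>; one more point keeps the exceptional set null.\<close>
  define N where "N = insert \<tau> N0"
  have N: "N \<in> null_sets lebesgue"
  proof -
    have "{\<tau>} \<in> null_sets lebesgue" by (simp add: null_sets_completionI)
    from null_sets.Un[OF this N0(1)] show ?thesis by (simp add: N_def)
  qed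
  define z where "z t = x t - t *\<^sub>R D" for t
  have "(norm D)-lipschitz_on {a..b} (\<lambda>t. t *\<^sub>R D)"
    by (rule lipschitz_onI) (auto simp: dist_norm simp flip: scaleR_left_diff_distrib)
  then have lipz: "(L + norm D)-lipschitz_on {a..b} z"
    unfolding z_def by (rule lipschitz_on_diff[OF lip])
  have seg: "norm (z t - z s) \<le> e * (t - s)"
    if st: "s \<le> t" "a \<le> s" "t \<le> b" "\<And>r. r \<in> {s..t} \<Longrightarrow> \<bar>r - \<tau>\<bar> < d" for s t
  proof (rule lipschitz_ae_derivative_bound[OF st(1) _ _ N])
    show "0 \<le> e" using e by simp
    show "(L + norm D)-lipschitz_on {s..t} z"
      using lipz by (rule lipschitz_on_subset) (use st in auto)
  next
    fix r assume r: "r \<in> {s..t} - N"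
    then have "(x has_vector_derivative w r) (at r)"
      using subsetD[OF N0(2), of r] st by (auto simp: N_def)
    then have "(x has_vector_derivative w r) (at r within {s..t})"
      by (rule has_vector_derivative_at_within)
    then show "(z has_vector_derivative (w r - D)) (at r within {s..t})"
      unfolding z_def by (auto intro!: derivative_eq_intros)
    have "P r" using d(2)[of r] r st by (auto simp: N_def dist_real_def)
    moreover have "Q r" using r N0(2) by (auto simp: N_def)
    ultimately show "norm (w r - D) \<le> e" using PQ by (simp add: less_imp_le)
  qed
  have "norm (x t - x \<tau> - (t - \<tau>) *\<^sub>R D) \<le> e * norm (t - \<tau>)"
    if t: "t \<in> {a..b}" "norm (t - \<tau>) < d" for t
  proof -
    have eq: "x t - x \<tau> - (t - \<tau>) *\<^sub>R D = z t - z \<tau>"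
      by (simp add: z_def algebra_simps)
    show ?thesis
    proof (cases "\<tau> \<le> t")
      case True
      then show ?thesis using seg[of \<tau> t] t \<tau> eq by simp
    next
      case False
      then have "norm (z \<tau> - z t) \<le> e * (\<tau> - t)" using seg[of t \<tau>] t \<tau> by simp
      then show ?thesis using False unfolding eq by (simp add: norm_minus_commute)
    qed
  qed
  then show "\<exists>d>0. \<forall>y\<in>{a..b}. norm (y - \<tau>) < d \<longrightarrow>
      norm (x y - x \<tau> - (y - \<tau>) *\<^sub>R D) \<le> e * norm (y - \<tau>)"
    using d(1) by blast
qed

lemma right_derivative_at_max:
  fixes y :: "real \<Rightarrow> real"
  assumes "(y has_real_derivative d) (at \<tau> within {\<tau>..b})" and "\<tau> < b"
    and "\<And>t. t \<in> {\<tau>..b} \<Longrightarrow> y t \<le> y \<tau>"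
  shows "d \<le> 0"
proof (rule tendsto_upperbound)
  show "((\<lambda>t. (y t - y \<tau>) / (t - \<tau>)) \<longlongrightarrow> d) (at_right \<tau>)"
    using assms(1,2) by (simp add: has_field_derivative_iff at_within_Icc_at_right)
  show "eventually (\<lambda>t. (y t - y \<tau>) / (t - \<tau>) \<le> 0) (at_right \<tau>)"
    using eventually_at_right_less[of \<tau>] order_tendstoD(2)[OF tendsto_ident_at assms(2)]
    by eventually_elim (use assms(3) in \<open>auto simp: divide_le_0_iff\<close>)
qed simp

lemma left_derivative_at_max:
  fixes y :: "real \<Rightarrow> real"
  assumes "(y has_real_derivative d) (at \<tau> within {a..\<tau>})" and "a < \<tau>"
    and "\<And>t. t \<in> {a..\<tau>} \<Longrightarrow> y t \<le> y \<tau>"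
  shows "0 \<le> d"
proof (rule tendsto_lowerbound)
  show "((\<lambda>t. (y t - y \<tau>) / (t - \<tau>)) \<longlongrightarrow> d) (at_left \<tau>)"
    using assms(1,2) by (simp add: has_field_derivative_iff at_within_Icc_at_left)
  have "eventually (\<lambda>t. t < \<tau>) (at_left \<tau>)"
    by (simp add: eventually_at_filter)
  then show "eventually (\<lambda>t. 0 \<le> (y t - y \<tau>) / (t - \<tau>)) (at_left \<tau>)"
    using order_tendstoD(1)[OF tendsto_ident_at assms(2)]
    by eventually_elim (use assms(3) in \<open>auto simp: zero_le_divide_iff\<close>)
qed simp

section \<open>Functions of bounded variation\<close>

text \<open>
  The Jordan decomposition: both the total variation \<open>V t\<close> on \<open>{0..t}\<close> and \<open>V t - h t\<close> are
  nondecreasing.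
\<close>

lemma BV_measurable_real:
  fixes h :: "real \<Rightarrow> real"
  assumes h: "h \<in> BV T"
  shows "h \<in> borel_measurable (lebesgue_on {0..T})"
proof -
  define part where "part t N s \<longleftrightarrow> (\<forall>k\<le>N. s k \<in> {0..t}) \<and> (\<forall>k<N. s k \<le> s (Suc k))"
    for t :: real and N :: nat and s :: "nat \<Rightarrow> real"
  define var where "var N s = (\<Sum>k<N. \<bar>h (s (Suc k)) - h (s k)\<bar>)" for N :: nat and s :: "nat \<Rightarrow> real"
  define V where "V t = Sup {var N s | N s. part t N s}" for t
  obtain C where C: "\<And>N s. part T N s \<Longrightarrow> var N s \<le> C"
    using h unfolding BV_def part_def var_def by auto
  have upper: "var N s \<le> V t" if "part t N s" "t \<le> T" for N s t
    unfolding V_def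
  proof (rule cSup_upper)
    have "part T N s" if "part t N s" for N s using that \<open>t \<le> T\<close> unfolding part_def by force
    then show "bdd_above {var N s | N s. part t N s}"
      using C by (intro bdd_aboveI[of _ C]) blast
  qed (use that in blast)
  have step: "V a + \<bar>h b - h a\<bar> \<le> V b" if ab: "0 \<le> a" "a \<le> b" "b \<le> T" for a b
  proof -
    have "V a \<le> V b - \<bar>h b - h a\<bar>"
      unfolding V_def[of a]
    proof (rule cSup_least)
      have "part a 0 (\<lambda>_. 0)" using ab by (simp add: part_def)
      then show "{var N s | N s. part a N s} \<noteq> {}" by blast
    next
      fix c assume "c \<in> {var N s | N s. part a N s}"
      then obtain N s where Ns: "part a N s" "c = var N s" by blast
      \<comment> \<open>Appending both \<open>a\<close> and \<open>b\<close> to a partition of \<open>{0..a}\<close> gains the whole increment from \<open>a\<close> to \<open>b\<close>.\<close>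
      define s' where "s' k = (if k \<le> N then s k else if k = Suc N then a else b)" for k
      have "part b (Suc (Suc N)) s'"
        using Ns(1) ab unfolding part_def s'_def by (auto simp: less_Suc_eq) 
      moreover have "var (Suc (Suc N)) s' = var N s + \<bar>h a - h (s N)\<bar> + \<bar>h b - h a\<bar>"
        unfolding var_def by (simp add: s'_def)
      ultimately show "c \<le> V b - \<bar>h b - h a\<bar>"
        using upper[of b "Suc (Suc N)" s'] ab(3) Ns(2) by simp
    qed
    then show ?thesis by simp
  qed
  have "mono_on {0..T} V"
    using step by (intro mono_onI) (smt (verit) atLeastAtMost_iff)
  moreover have "mono_on {0..T} (\<lambda>t. V t - h t)"
    using step by (intro mono_onI) (smt (verit) atLeastAtMost_iff)
  ultimately have "(\<lambda>t. V t - (V t - h t)) \<in> borel_measurable (restrict_space borel {0..T})"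
    by (intro borel_measurable_diff borel_measurable_mono_on_fnc)
  then have "h \<in> borel_measurable (restrict_space borel {0..T})" by simp
  then show ?thesis
    by (metis borel_measurable_subalgebra mono_restrict_space space_lborel space_restrict_space sets_completionI_sets sets_lborel subsetI space_borel space_completion)
qed

lemma BV_inner:
  fixes p :: "real \<Rightarrow> 'a::real_inner"
  assumes p: "p \<in> BV T"
  shows "(\<lambda>t. p t \<bullet> v) \<in> BV T"
proof -
  obtain C where C: "\<And>N s. \<lbrakk>\<forall>k\<le>N. s k \<in> {0..T}; \<forall>k<N. s k \<le> s (Suc k)\<rbrakk> \<Longrightarrow>
      (\<Sum>k<N. norm (p (s (Suc k)) - p (s k))) \<le> C"
    using p unfolding BV_def by blast
  have "(\<Sum>k<N. norm (p (s (Suc k)) \<bullet> v - p (s k) \<bullet> v)) \<le> C * norm v"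
    if "\<forall>k\<le>N. s k \<in> {0..T}" "\<forall>k<N. s k \<le> s (Suc k)" for N and s :: "nat \<Rightarrow> real"
  proof -
    have "(\<Sum>k<N. norm (p (s (Suc k)) \<bullet> v - p (s k) \<bullet> v))
        \<le> (\<Sum>k<N. norm (p (s (Suc k)) - p (s k)) * norm v)"
      by (intro sum_mono) (simp add: Cauchy_Schwarz_ineq2 flip: inner_diff_left)
    also have "\<dots> \<le> C * norm v"
      using C[OF that] by (simp add: mult_right_mono flip: sum_distrib_right)
    finally show ?thesis .
  qed
  then show ?thesis unfolding BV_def by blast
qed

lemma BV_measurable:
  fixes p :: "real \<Rightarrow> 'a::euclidean_space"
  assumes "p \<in> BV T"
  shows "p \<in> borel_measurable (lebesgue_on {0..T})"
  unfolding borel_measurable_euclidean_space[of p]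
  by (intro ballI BV_measurable_real BV_inner assms)

lemma BV_bounded:
  assumes "p \<in> BV T"
  obtains C where "C \<ge> 0" "\<And>t. t \<in> {0..T} \<Longrightarrow> norm (p t) \<le> C"
proof -
  obtain C where C: "\<And>N s. \<lbrakk>\<forall>k\<le>N. s k \<in> {0..T}; \<forall>k<N. s k \<le> s (Suc k)\<rbrakk> \<Longrightarrow>
      (\<Sum>k<N. norm (p (s (Suc k)) - p (s k))) \<le> C"
    using assms unfolding BV_def by blast
  have "norm (p t) \<le> \<bar>C\<bar> + norm (p 0)" if "t \<in> {0..T}" for t
  proof -
    have "norm (p t - p 0) \<le> C"
      using C[of 1 "\<lambda>k. if k = 0 then 0 else t"] that by auto
    then show ?thesis using norm_triangle_ineq[of "p t - p 0" "p 0"] by simp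
  qed
  then show thesis using that[of "\<bar>C\<bar> + norm (p 0)"] by simp
qed

section \<open>First derivatives\<close>

lemma C2_imp_C1:
  fixes h :: "'a::real_normed_vector \<Rightarrow> 'b::real_normed_vector"
  assumes "C2 h"
  obtains h' :: "'a \<Rightarrow> 'a \<Rightarrow>\<^sub>L 'b"
  where "\<And>x. (h has_derivative blinfun_apply (h' x)) (at x)" "continuous_on UNIV h'"
proof -
  obtain h' :: "'a \<Rightarrow> 'a \<Rightarrow>\<^sub>L 'b" and h'' where
    h: "\<And>x. (h has_derivative blinfun_apply (h' x)) (at x)"
       "\<And>x. (h' has_derivative blinfun_apply (h'' x)) (at x)"
    using assms unfolding C2_def by blast
  have "continuous_on UNIV h'"
    by (rule continuous_at_imp_continuous_on) (blast intro: has_derivative_continuous h(2))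
  then show thesis using h(1) that by blast
qed

lemma row_deriv_inner:
  assumes "g differentiable (at x)"
  shows "frechet_derivative g (at x) y = row_deriv g x \<bullet> y"
proof -
  have lin: "linear (frechet_derivative g (at x))" using assms by (rule linear_frechet_derivative)
  have y: "y = (\<Sum>i\<in>UNIV. y $ i *\<^sub>R axis i 1)"
    by (simp add: vec_eq_iff axis_def if_distrib sum.delta cong: if_cong)
  have "frechet_derivative g (at x) y =
      frechet_derivative g (at x) (\<Sum>i\<in>UNIV. y $ i *\<^sub>R axis i 1)"
    by (rule arg_cong[OF y])
  also have "\<dots> = (\<Sum>i\<in>UNIV. y $ i *\<^sub>R frechet_derivative g (at x) (axis i 1))"
    by (simp add: linear_sum[OF lin] linear_scale[OF lin])
  finally show ?thesis by (simp add: row_deriv_def inner_vec_def mult.commute)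
qed

lemma continuous_on_row_deriv:
  assumes "C2 g"
  shows "continuous_on S (row_deriv g)"
proof -
  obtain g' where g': "\<And>x. (g has_derivative blinfun_apply (g' x)) (at x)" "continuous_on UNIV g'"
    using C2_imp_C1[OF assms] by blast
  have "row_deriv g = (\<lambda>x. \<chi> i. g' x (axis i 1))"
    by (simp add: row_deriv_def fun_eq_iff frechet_derivative_at[OF g'(1), symmetric])
  then show ?thesis
    by (simp add: continuous_on_subset[OF g'(2)] continuous_intros)
qed

lemma row_deriv_chain:
  assumes "g differentiable (at (x \<tau>))" and "(x has_vector_derivative D) (at \<tau> within S)"
  shows "((\<lambda>t. g (x t)) has_real_derivative (row_deriv g (x \<tau>) \<bullet> D)) (at \<tau> within S)"
proof -
  have "(g has_derivative frechet_derivative g (at (x \<tau>))) (at (x \<tau>))"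
    using assms(1) by (simp add: frechet_derivative_works)
  moreover have "frechet_derivative g (at (x \<tau>)) = (\<lambda>y. row_deriv g (x \<tau>) \<bullet> y)"
    using row_deriv_inner[OF assms(1)] by blast
  ultimately have "(g has_derivative (\<lambda>y. row_deriv g (x \<tau>) \<bullet> y)) (at (x \<tau>))" by simp
  from has_derivative_compose[OF assms(2)[unfolded has_vector_derivative_def] this]
  have "((\<lambda>t. g (x t)) has_derivative (\<lambda>h. h * (row_deriv g (x \<tau>) \<bullet> D))) (at \<tau> within S)"
    by simp
  then show ?thesis
    unfolding has_field_derivative_def by (simp only: mult_commute_abs)
qed

section \<open>One-sided limits of integrals\<close>

text \<open>
  By dominated convergence: the indicators of \<open>{a..t}\<close> converge pointwise to that of \<open>{a..\<tau>}\<close> as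
  \<open>t\<close> decreases to \<open>\<tau>\<close>, and to that of \<open>{a..<\<tau>}\<close> as \<open>t\<close> increases to \<open>\<tau>\<close>. The two limits differ by
  the atom at \<open>\<tau>\<close>. Applied to Lebesgue measure, to the multiplier measure, and to the constant
  function \<open>1\<close>, this gives the continuity or the jump of every integral in the proof.
\<close>

lemma set_integral_one_sided_limits:
  fixes f :: "real \<Rightarrow> 'a::{banach,second_countable_topology}"
  assumes f: "set_integrable N {a..b} f"
    and sets: "\<And>t. t \<le> b \<Longrightarrow> {a..t} \<in> sets N" "\<And>t. t \<le> b \<Longrightarrow> {a..<t} \<in> sets N"
    and \<tau>: "\<tau> < b"
  shows "((\<lambda>t. LINT s:{a..t}|N. f s) \<longlongrightarrow> (LINT s:{a..\<tau>}|N. f s)) (at_right \<tau>)"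
    and "((\<lambda>t. LINT s:{a..t}|N. f s) \<longlongrightarrow> (LINT s:{a..<\<tau>}|N. f s)) (at_left \<tau>)"
proof -
  have conv: "(\<lambda>n. LINT s:{a..X n}|N. f s) \<longlonglongrightarrow> (LINT s:A|N. f s)"
    if X: "\<And>n. X n \<le> b" and A: "A \<in> sets N" "A \<subseteq> {a..b}"
      and ind: "\<And>s. eventually (\<lambda>n. indicator {a..X n} s = (indicator A s :: real)) sequentially"
    for X :: "nat \<Rightarrow> real" and A
    unfolding set_lebesgue_integral_def
  proof (rule integral_dominated_convergence)
    show "(\<lambda>s. indicat_real A s *\<^sub>R f s) \<in> borel_measurable N"
      using set_integrable_subset[OF f A] unfolding set_integrable_def by auto
    show "(\<lambda>s. indicat_real {a..X n} s *\<^sub>R f s) \<in> borel_measurable N" for n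
      using set_integrable_subset[OF f sets(1)[OF X[of n]]] X[of n] unfolding set_integrable_def by auto
    show "integrable N (\<lambda>s. norm (indicat_real {a..b} s *\<^sub>R f s))"
      using f unfolding set_integrable_def by (rule integrable_norm)
    show "AE s in N. (\<lambda>n. indicat_real {a..X n} s *\<^sub>R f s) \<longlonglongrightarrow> indicat_real A s *\<^sub>R f s"
    proof (rule AE_I2)
      fix s
      show "(\<lambda>n. indicat_real {a..X n} s *\<^sub>R f s) \<longlonglongrightarrow> indicat_real A s *\<^sub>R f s"
        by (rule tendsto_eventually) (use ind[of s] in \<open>auto elim: eventually_mono\<close>)
    qed
    show "AE s in N. norm (indicat_real {a..X n} s *\<^sub>R f s) \<le> norm (indicat_real {a..b} s *\<^sub>R f s)" for n
      using X[of n] by (auto simp: indicator_def)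
  qed
  show "((\<lambda>t. LINT s:{a..t}|N. f s) \<longlongrightarrow> (LINT s:{a..\<tau>}|N. f s)) (at_right \<tau>)"
  proof (rule tendsto_at_right_sequentially[OF \<tau>])
    fix X :: "nat \<Rightarrow> real" assume X: "\<And>n. \<tau> < X n" "\<And>n. X n < b" "decseq X" "X \<longlonglongrightarrow> \<tau>"
    show "(\<lambda>n. LINT s:{a..X n}|N. f s) \<longlonglongrightarrow> (LINT s:{a..\<tau>}|N. f s)"
    proof (rule conv)
      fix s
      show "eventually (\<lambda>n. indicator {a..X n} s = (indicator {a..\<tau>} s :: real)) sequentially"
      proof (cases "s \<le> \<tau>")
        case True
        then show ?thesis using X(1) by (auto simp: indicator_def intro!: always_eventually) (metis less_imp_le order_trans)
      next
        case False
        then have "eventually (\<lambda>n. X n < s) sequentially" using order_tendstoD(2)[OF X(4)] by simp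
        then show ?thesis by eventually_elim (use False in \<open>auto simp: indicator_def\<close>)
      qed
    qed (use X(2) \<tau> sets in \<open>auto simp: less_imp_le\<close>)
  qed
  show "((\<lambda>t. LINT s:{a..t}|N. f s) \<longlongrightarrow> (LINT s:{a..<\<tau>}|N. f s)) (at_left \<tau>)"
  proof (rule tendsto_at_left_sequentially[of "\<tau> - 1"])
    fix X :: "nat \<Rightarrow> real" assume X: "\<And>n. X n < \<tau>" "incseq X" "X \<longlonglongrightarrow> \<tau>"
    show "(\<lambda>n. LINT s:{a..X n}|N. f s) \<longlonglongrightarrow> (LINT s:{a..<\<tau>}|N. f s)"
    proof (rule conv)
      fix n show "X n \<le> b" using X(1)[of n] \<tau> by simp
    next
      fix s
      show "eventually (\<lambda>n. indicator {a..X n} s = (indicator {a..<\<tau>} s :: real)) sequentially"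
      proof (cases "s < \<tau>")
        case True
        then have "eventually (\<lambda>n. s < X n) sequentially" using order_tendstoD(1)[OF X(3)] by simp
        then show ?thesis by eventually_elim (use True in \<open>auto simp: indicator_def\<close>)
      next
        case False
        then show ?thesis using X(1) by (auto simp: indicator_def intro!: always_eventually) (meson le_less_trans)
      qed
    qed (use \<tau> sets in auto)
  qed simp
qed

lemma set_integral_singleton:
  fixes h :: "'a \<Rightarrow> 'b::{banach,second_countable_topology}"
  assumes "{c} \<in> sets M" "emeasure M {c} \<noteq> \<infinity>"
  shows "set_integrable M {c} h" "(LINT s:{c}|M. h s) = measure M {c} *\<^sub>R h c"
proof -
  have eq: "(\<lambda>s. indicat_real {c} s *\<^sub>R h s) = (\<lambda>s. indicat_real {c} s *\<^sub>R h c)"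
    by (auto simp: indicator_def)
  have int: "integrable M (indicat_real {c})"
    using assms by (simp add: less_top)
  then show "set_integrable M {c} h" unfolding set_integrable_def eq by simp
  show "(LINT s:{c}|M. h s) = measure M {c} *\<^sub>R h c"
    unfolding set_lebesgue_integral_def eq using int sets.sets_into_space[OF assms(1)]
    by (simp add: Int_absorb2)
qed

lemma set_integral_Icc_split:
  fixes h :: "real \<Rightarrow> 'b::{banach,second_countable_topology}"
  assumes "set_integrable M {a..<c} h" "{c} \<in> sets M" "emeasure M {c} \<noteq> \<infinity>" "a \<le> c"
  shows "(LINT s:{a..c}|M. h s) = (LINT s:{a..<c}|M. h s) + measure M {c} *\<^sub>R h c"
proof -
  have "{a..c} = {a..<c} \<union> {c}" using assms(4) by auto
  then show ?thesis
    using set_integral_Un[of "{a..<c}" "{c}" M h] set_integral_singleton[OF assms(2,3), of h] assms(1)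
    by simp
qed

lemma isCont_bv_primitive:
  assumes \<tau>: "0 < \<tau>" "\<tau> < T"
    and M: "finite_measure M" "sets M = sets (restrict_space borel {0..T})"
    and atom: "measure M {\<tau>} = 0"
  shows "isCont (bv_primitive T M) \<tau>"
proof -
  interpret finite_measure M by (rule M(1))
  have setsM: "A \<in> sets M" if "A \<in> sets borel" "A \<subseteq> {0..T}" for A
    using that by (auto simp: M(2) sets_restrict_space_iff)
  have one: "set_integrable M A (\<lambda>_. 1::real)" "(LINT s:A|M. 1::real) = measure M A" if "A \<in> sets M" for A
    using that sets.sets_into_space[OF that]
    by (auto simp: set_integrable_def set_lebesgue_integral_def Int_absorb2 less_top[symmetric])
  have prim: "bv_primitive T M t = (LINT s:{0..t}|M. 1) - measure M {0..T}" if "0 < t" "t < T" for t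
  proof -
    have "measure M ({0..t} \<union> {t<..T}) = measure M {0..t} + measure M {t<..T}"
      using that by (intro finite_measure_Union setsM) auto
    moreover have "{0..t} \<union> {t<..T} = {0..T}" using that by auto
    ultimately show ?thesis using that one(2)[OF setsM[of "{0..t}"]] by (auto simp: bv_primitive_def)
  qed
  have eq: "(LINT s:{0..\<tau>}|M. 1::real) = (LINT s:{0..<\<tau>}|M. 1)"
    using set_integral_Icc_split[of M 0 \<tau> "\<lambda>_. 1::real"] one(1)[OF setsM, of "{0..<\<tau>}"]
      setsM[of "{\<tau>}"] atom \<tau> by (auto simp: subset_iff)
  note L = set_integral_one_sided_limits[OF one(1)[OF setsM[of "{0..T}"]] _ _ \<tau>(2)]
  have "((\<lambda>t. LINT s:{0..t}|M. 1::real) \<longlongrightarrow> (LINT s:{0..\<tau>}|M. 1)) (at \<tau>)"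
  proof (rule filterlim_split_at)
    show "((\<lambda>t. LINT s:{0..t}|M. 1::real) \<longlongrightarrow> (LINT s:{0..\<tau>}|M. 1)) (at_right \<tau>)"
      by (rule L(1)) (auto intro!: setsM)
    show "((\<lambda>t. LINT s:{0..t}|M. 1::real) \<longlongrightarrow> (LINT s:{0..\<tau>}|M. 1)) (at_left \<tau>)"
      unfolding eq by (rule L(2)) (auto intro!: setsM)
  qed
  then have "((\<lambda>t. (LINT s:{0..t}|M. 1::real) - measure M {0..T}) \<longlongrightarrow> bv_primitive T M \<tau>) (at \<tau>)"
    unfolding prim[OF \<tau>] by (intro tendsto_intros)
  moreover have "eventually (\<lambda>t. (LINT s:{0..t}|M. 1::real) - measure M {0..T} = bv_primitive T M t) (at \<tau>)"
    using order_tendstoD(1)[OF tendsto_ident_at \<tau>(1)] order_tendstoD(2)[OF tendsto_ident_at \<tau>(2)]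
    by eventually_elim (simp add: prim)
  ultimately show ?thesis
    unfolding isCont_def by (rule Lim_transform_eventually)
qed

section \<open>The jump of the costate\<close>

lemma continuous_on_bounded_interval:
  fixes c :: "real \<Rightarrow> 'a::real_normed_vector"
  assumes "continuous_on {a..b} c"
  obtains C where "C \<ge> 0" "\<And>t. t \<in> {a..b} \<Longrightarrow> norm (c t) \<le> C"
  using compact_imp_bounded[OF compact_continuous_image[OF assms]]
  unfolding bounded_pos by (metis compact_Icc image_eqI less_imp_le)

lemma continuous_on_lebesgue_measurable:
  fixes c :: "real \<Rightarrow> 'a::euclidean_space"
  assumes "continuous_on {a..b} c"
  shows "c \<in> borel_measurable (lebesgue_on {a..b})"
  using assms by (rule continuous_imp_measurable_on_sets_lebesgue) simp

text \<open>
  The integral of a non-integrable function is \<open>0\<close> by convention, so without integrability the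
  Lebesgue term of the costate equation could jump at \<open>\<tau>\<close>. The integrand is measurable and essentially bounded, because its components are
  \<open>p f0'(x) e + u (p f1'(x) e)\<close> for the unit vectors \<open>e\<close>, with \<open>p\<close> of bounded variation, \<open>u\<close>
  essentially bounded and the other factors continuous.
\<close>

lemma adjoint_integrand_integrable:
  fixes f0 f1 :: "real^'n \<Rightarrow> real^'n" and p x :: "real \<Rightarrow> real^'n"
  assumes p: "p \<in> BV T" and u: "u \<in> Linf T" and x: "continuous_on {0..T} x"
    and f: "C2 f0" "C2 f1"
  shows "set_integrable lebesgue {0..T} (\<lambda>s. p s v* jacobian (\<lambda>y. f0 y + u s *\<^sub>R f1 y) (at (x s)))"
proof -
  obtain F0 where F0: "\<And>x. (f0 has_derivative blinfun_apply (F0 x)) (at x)" "continuous_on UNIV F0"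
    using C2_imp_C1[OF f(1)] by blast
  obtain F1 where F1: "\<And>x. (f1 has_derivative blinfun_apply (F1 x)) (at x)" "continuous_on UNIV F1"
    using C2_imp_C1[OF f(2)] by blast
  define c0 where "c0 j s = F0 (x s) (axis j 1)" for j s
  define c1 where "c1 j s = F1 (x s) (axis j 1)" for j s
  have cont: "continuous_on {0..T} (c0 j)" "continuous_on {0..T} (c1 j)" for j
    unfolding c0_def c1_def
    by (intro continuous_intros continuous_on_compose2[OF F0(2) x] continuous_on_compose2[OF F1(2) x]; simp)+
  define q where "q j s = p s \<bullet> c0 j s + u s * (p s \<bullet> c1 j s)" for j s
  have eq: "p s v* jacobian (\<lambda>y. f0 y + u s *\<^sub>R f1 y) (at (x s)) = (\<Sum>j\<in>UNIV. q j s *\<^sub>R axis j 1)" for s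
  proof -
    have "((\<lambda>y. f0 y + u s *\<^sub>R f1 y) has_derivative (\<lambda>h. F0 (x s) h + u s *\<^sub>R F1 (x s) h)) (at (x s))"
      by (intro derivative_intros F0 F1)
    then have "frechet_derivative (\<lambda>y. f0 y + u s *\<^sub>R f1 y) (at (x s)) = (\<lambda>h. F0 (x s) h + u s *\<^sub>R F1 (x s) h)"
      by (rule frechet_derivative_at[symmetric])
    then show ?thesis
      by (simp add: jacobian_def matrix_def vector_matrix_mult_def vec_eq_iff axis_def if_distrib
          sum.delta q_def c0_def c1_def inner_vec_def algebra_simps sum.distrib sum_distrib_left cong: if_cong)
  qed
  obtain Cu where Cu: "AE t in lebesgue_on {0..T}. \<bar>u t\<bar> \<le> Cu"
    and um: "u \<in> borel_measurable (lebesgue_on {0..T})"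
    using u unfolding Linf_def by blast
  obtain Cp where Cp: "Cp \<ge> 0" "\<And>t. t \<in> {0..T} \<Longrightarrow> norm (p t) \<le> Cp"
    using BV_bounded[OF p] by blast
  interpret finite_measure "lebesgue_on {0..T}"
    by (rule finite_measure_lebesgue_on) simp
  have int: "integrable (lebesgue_on {0..T}) (q j)" for j
  proof -
    obtain C0 where C0: "C0 \<ge> 0" "\<And>t. t \<in> {0..T} \<Longrightarrow> norm (c0 j t) \<le> C0"
      using continuous_on_bounded_interval[OF cont(1)] by blast
    obtain C1 where C1: "C1 \<ge> 0" "\<And>t. t \<in> {0..T} \<Longrightarrow> norm (c1 j t) \<le> C1"
      using continuous_on_bounded_interval[OF cont(2)] by blast
    show ?thesis
    proof (rule integrable_const_bound)
      show "q j \<in> borel_measurable (lebesgue_on {0..T})"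
        unfolding q_def using BV_measurable[OF p] um
          continuous_on_lebesgue_measurable[OF cont(1)] continuous_on_lebesgue_measurable[OF cont(2)]
        by measurable
      have bd: "\<bar>p t \<bullet> c\<bar> \<le> Cp * C" if "t \<in> {0..T}" "norm c \<le> C" for t c C
        using Cauchy_Schwarz_ineq2[of "p t" c] mult_mono[OF Cp(2)[OF that(1)] that(2)] Cp(1)
        by simp
      have "AE t in lebesgue_on {0..T}. t \<in> {0..T}"
        by (rule AE_I2) simp
      then show "AE t in lebesgue_on {0..T}. norm (q j t) \<le> Cp * C0 + Cu * (Cp * C1)"
        using Cu
      proof eventually_elim
        case (elim t)
        have "\<bar>u t * (p t \<bullet> c1 j t)\<bar> \<le> Cu * (Cp * C1)"
          unfolding abs_mult using elim bd[OF _ C1(2)] by (intro mult_mono) auto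
        then show ?case using bd[OF elim(1) C0(2)[OF elim(1)]] unfolding q_def real_norm_def by linarith
      qed
    qed
  qed
  have "integrable (lebesgue_on {0..T}) (\<lambda>s. p s v* jacobian (\<lambda>y. f0 y + u s *\<^sub>R f1 y) (at (x s)))"
    unfolding eq using int by (intro Bochner_Integration.integrable_sum) simp
  then show ?thesis
    unfolding set_integrable_def by (subst (asm) integrable_restrict_space) simp_all
qed

text \<open>
  The Lebesgue term of the costate equation is continuous at \<open>\<tau>\<close>, so only the atom of \<open>M\<close> makes
  the costate jump. The equation fixes \<open>p\<close> only almost everywhere, hence the essential limits.
\<close>

lemma costate_jump:
  fixes f0 f1 :: "real^'n \<Rightarrow> real^'n" and p x :: "real \<Rightarrow> real^'n"
  assumes \<tau>: "0 < \<tau>" "\<tau> < T" and p: "p \<in> BV T" and u: "u \<in> Linf T"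
    and x: "continuous_on {0..T} x" and f: "C2 f0" "C2 f1" and g: "C2 g"
    and M: "finite_measure M" "sets M = sets (restrict_space borel {0..T})"
    and costate: "costate_eq T f0 f1 g u x p M"
  obtains pl pr where "(p \<longlongrightarrow> pl) (ess_left \<tau>)" "(p \<longlongrightarrow> pr) (ess_right \<tau>)"
    "pr - pl = - (measure M {\<tau>} *\<^sub>R row_deriv g (x \<tau>))"
proof -
  interpret finite_measure M by (rule M(1))
  define q where "q s = p s v* jacobian (\<lambda>y. f0 y + u s *\<^sub>R f1 y) (at (x s))" for s
  define h where "h s = row_deriv g (x s)" for s
  define I where "I t = (LINT s:{0..t}|lebesgue. q s)" for t
  define J where "J t = (LINT s:{0..t}|M. h s)" for t
  have setsM: "A \<in> sets M" if "A \<in> sets borel" "A \<subseteq> {0..T}" for A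
    using that by (auto simp: M(2) sets_restrict_space_iff)
  have spM: "space M = {0..T}"
    using sets_eq_imp_space_eq[OF M(2)] by (simp add: space_restrict_space)
  have q: "set_integrable lebesgue {0..T} q"
    unfolding q_def by (rule adjoint_integrand_integrable[OF p u x f])
  have hc: "continuous_on {0..T} h"
    unfolding h_def by (rule continuous_on_compose2[OF continuous_on_row_deriv[OF g] x]) auto
  have h: "set_integrable M {0..T} h"
  proof -
    obtain C where C: "\<And>t. t \<in> {0..T} \<Longrightarrow> norm (h t) \<le> C"
      using continuous_on_bounded_interval[OF hc] by blast
    have "h \<in> borel_measurable M"
      using borel_measurable_continuous_on_restrict[OF hc] M(2) measurable_cong_sets by blast
    then have "integrable M h"
      using C by (intro integrable_const_bound[of _ C] AE_I2) (auto simp: spM)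
    then show ?thesis
      unfolding set_integrable_def by (intro integrable_mult_indicator) (auto intro: setsM)
  qed
  have limI: "(I \<longlongrightarrow> I \<tau>) (at_right \<tau>)" "(I \<longlongrightarrow> I \<tau>) (at_left \<tau>)"
  proof -
    note L = set_integral_one_sided_limits[OF q _ _ \<tau>(2)]
    show "(I \<longlongrightarrow> I \<tau>) (at_right \<tau>)" unfolding I_def by (rule L(1)) auto
    have "set_integrable lebesgue {0..<\<tau>} q"
      using q by (rule set_integrable_subset) (use \<tau> in auto)
    then have "I \<tau> = (LINT s:{0..<\<tau>}|lebesgue. q s)"
      unfolding I_def using \<tau> by (subst set_integral_Icc_split) auto
    then show "(I \<longlongrightarrow> I \<tau>) (at_left \<tau>)"
      using L(2) unfolding I_def by simp
  qed
  define Jl where "Jl = (LINT s:{0..<\<tau>}|M. h s)"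
  have limJ: "(J \<longlongrightarrow> J \<tau>) (at_right \<tau>)" "(J \<longlongrightarrow> Jl) (at_left \<tau>)"
    unfolding J_def Jl_def
    by (rule set_integral_one_sided_limits[OF h _ _ \<tau>(2)]; rule setsM; auto)+
  have "set_integrable M {0..<\<tau>} h"
    using h by (rule set_integrable_subset) (use \<tau> in \<open>auto intro!: setsM\<close>)
  then have J: "J \<tau> = Jl + measure M {\<tau>} *\<^sub>R h \<tau>"
    unfolding J_def Jl_def using \<tau> by (intro set_integral_Icc_split setsM) auto
  have ae: "AE t in lebesgue_on {0..T}. p 0 - (I t + J t) = p t"
    using costate unfolding costate_eq_def Let_def I_def J_def q_def h_def
    by (auto elim!: eventually_mono simp: algebra_simps)
  note ess = eventually_ess_at[OF ae \<tau>]
  have "((\<lambda>t. p 0 - (I t + J t)) \<longlongrightarrow> p 0 - (I \<tau> + Jl)) (ess_left \<tau>)"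
    by (intro tendsto_intros tendsto_mono[OF ess_at_le] limI limJ)
  then have "(p \<longlongrightarrow> p 0 - (I \<tau> + Jl)) (ess_left \<tau>)"
    by (rule Lim_transform_eventually[OF _ ess])
  moreover have "((\<lambda>t. p 0 - (I t + J t)) \<longlongrightarrow> p 0 - (I \<tau> + J \<tau>)) (ess_right \<tau>)"
    by (intro tendsto_intros tendsto_mono[OF ess_at_le] limI limJ)
  then have "(p \<longlongrightarrow> p 0 - (I \<tau> + J \<tau>)) (ess_right \<tau>)"
    by (rule Lim_transform_eventually[OF _ ess])
  ultimately show thesis
    by (rule that) (simp add: J h_def)
qed

section \<open>The jump of the state derivative and of the control\<close>

lemma state_one_sided_derivatives:
  fixes x :: "real \<Rightarrow> real^'n"
  assumes \<tau>: "0 < \<tau>" "\<tau> < T" and x: "L-lipschitz_on {0..T} x"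
    and f: "continuous_on UNIV f0" "continuous_on UNIV f1"
    and der: "AE t in lebesgue_on {0..T}. (x has_vector_derivative (f0 (x t) + u t *\<^sub>R f1 (x t))) (at t)"
  shows "(u \<longlongrightarrow> r) (ess_right \<tau>) \<Longrightarrow>
      (x has_vector_derivative (f0 (x \<tau>) + r *\<^sub>R f1 (x \<tau>))) (at \<tau> within {\<tau>..T})" (is "?R \<Longrightarrow> ?Rd")
    and "(u \<longlongrightarrow> l) (ess_left \<tau>) \<Longrightarrow>
      (x has_vector_derivative (f0 (x \<tau>) + l *\<^sub>R f1 (x \<tau>))) (at \<tau> within {0..\<tau>})" (is "?L \<Longrightarrow> ?Ld")
proof -
  have "isCont x \<tau>"
    using continuous_on_interior[OF lipschitz_on_continuous_on[OF x]] \<tau> by simp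
  then have fx: "isCont (\<lambda>t. f0 (x t)) \<tau>" "isCont (\<lambda>t. f1 (x t)) \<tau>"
    using f by (auto intro: isCont_o2 simp: continuous_on_eq_continuous_at)
  have lim: "((\<lambda>t. f0 (x t) + u t *\<^sub>R f1 (x t)) \<longlongrightarrow> f0 (x \<tau>) + c *\<^sub>R f1 (x \<tau>)) (ess_at \<tau> S)"
    if "(u \<longlongrightarrow> c) (ess_at \<tau> S)" for c S
  proof -
    have "ess_at \<tau> S \<le> at \<tau>" by (meson ess_at_le at_le order_trans subset_UNIV)
    then show ?thesis
      using fx that by (intro tendsto_intros) (auto simp: isCont_def intro: tendsto_mono)
  qed
  have sub: "AE t in lebesgue_on {a..b}. (x has_vector_derivative (f0 (x t) + u t *\<^sub>R f1 (x t))) (at t)"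
    if "{a..b} \<subseteq> {0..T}" for a b
    using der that by (auto simp: AE_restrict_space_iff elim!: eventually_mono)
  show ?Rd if ?R
  proof (rule one_sided_vector_derivative)
    show "L-lipschitz_on {\<tau>..T} x" using x by (rule lipschitz_on_subset) (use \<tau> in auto)
    show "((\<lambda>t. f0 (x t) + u t *\<^sub>R f1 (x t)) \<longlongrightarrow> f0 (x \<tau>) + r *\<^sub>R f1 (x \<tau>)) (ess_at \<tau> {\<tau>..T})"
      using lim[OF that] \<tau> by (simp add: ess_at_def at_within_Icc_at_right)
  qed (use \<tau> in \<open>auto intro: sub\<close>)
  show ?Ld if ?L
  proof (rule one_sided_vector_derivative)
    show "L-lipschitz_on {0..\<tau>} x" using x by (rule lipschitz_on_subset) (use \<tau> in auto)
    show "((\<lambda>t. f0 (x t) + u t *\<^sub>R f1 (x t)) \<longlongrightarrow> f0 (x \<tau>) + l *\<^sub>R f1 (x \<tau>)) (ess_at \<tau> {0..\<tau>})"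
      using lim[OF that] \<tau> by (simp add: ess_at_def at_within_Icc_at_left)
  qed (use \<tau> in \<open>auto intro: sub\<close>)
qed

text \<open>
  Suppose that \<open>u\<close> tends to \<open>l\<close> along \<open>F\<close> and to a larger \<open>r\<close> along \<open>G\<close>. The limit \<open>l\<close> respects the
  lower bound, so along \<open>G\<close> the control finally exceeds \<open>umin\<close>, where minimality excludes \<open>H > 0\<close>;
  likewise along \<open>F\<close> it stays below \<open>umax\<close>, which excludes \<open>H < 0\<close>. With the filters left open,
  an upward and a downward jump are the same case.
\<close>

lemma control_min_cond_jump:
  assumes F: "F \<noteq> bot" and G: "G \<noteq> bot"
    and u: "(u \<longlongrightarrow> l) F" "(u \<longlongrightarrow> r) G"
    and H: "(H \<longlongrightarrow> hl) F" "(H \<longlongrightarrow> hr) G"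
    and bounds: "eventually (\<lambda>t. umin \<le> ereal (u t) \<and> ereal (u t) \<le> umax) F"
      "eventually (\<lambda>t. umin \<le> ereal (u t) \<and> ereal (u t) \<le> umax) G"
    and min: "eventually (\<lambda>t. control_min_cond umin umax (u t) (H t)) F"
      "eventually (\<lambda>t. control_min_cond umin umax (u t) (H t)) G"
    and less: "l < r"
  shows "hr \<le> 0" and "0 \<le> hl"
proof -
  have low: "umin \<le> ereal l"
    by (rule tendsto_lowerbound[OF tendsto_ereal[OF u(1)] _ F])
      (use bounds(1) in \<open>auto elim: eventually_mono\<close>)
  have "eventually (\<lambda>t. H t \<le> 0) G"
    using min(2) order_tendstoD(1)[OF u(2) less]
  proof eventually_elim
    case (elim t)
    have "umin < ereal (u t)" using low elim by (metis le_less_trans less_ereal.simps(1))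
    then have "\<not> (umin > -\<infinity> \<and> H t > 0)"
      using elim(1) unfolding control_min_cond_def by (metis order_less_irrefl)
    moreover have "umin = -\<infinity> \<longrightarrow> H t \<le> 0"
      using elim(1) unfolding control_min_cond_def by blast
    moreover have "umin = -\<infinity> \<or> umin > -\<infinity>" by (cases umin) auto
    ultimately show ?case by argo
  qed
  then show "hr \<le> 0" by (rule tendsto_upperbound[OF H(2) _ G])
  have up: "ereal r \<le> umax"
    by (rule tendsto_upperbound[OF tendsto_ereal[OF u(2)] _ G])
      (use bounds(2) in \<open>auto elim: eventually_mono\<close>)
  have "eventually (\<lambda>t. 0 \<le> H t) F"
    using min(1) order_tendstoD(2)[OF u(1) less]
  proof eventually_elim
    case (elim t)
    have "ereal (u t) < umax" using up elim by (metis less_le_trans less_ereal.simps(1))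
    then have "\<not> (umax < \<infinity> \<and> H t < 0)"
      using elim(1) unfolding control_min_cond_def by (metis order_less_irrefl)
    moreover have "umax = \<infinity> \<longrightarrow> 0 \<le> H t"
      using elim(1) unfolding control_min_cond_def by blast
    moreover have "umax = \<infinity> \<or> umax < \<infinity>" by (cases umax) auto
    ultimately show ?case by argo
  qed
  then show "0 \<le> hl" by (rule tendsto_lowerbound[OF H(1) _ F])
qed

theorem corollary2p6:
  fixes T :: real
    and f0 f1 :: "real^'n \<Rightarrow> real^'n"
    and \<phi> :: "(real^'n) \<times> (real^'n) \<Rightarrow> real"
    and g :: "real^'n \<Rightarrow> real"
    and n1 n2 :: nat
    and \<Phi> :: "nat \<Rightarrow> (real^'n) \<times> (real^'n) \<Rightarrow> real"
    and umin umax :: ereal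
    and u :: "real \<Rightarrow> real"
    and x :: "real \<Rightarrow> real^'n"
    and \<tau> :: real
  assumes "T > 0"
    and "C2 f0" and "\<exists>L. L-lipschitz_on UNIV f0"
    and "C2 f1" and "\<exists>L. L-lipschitz_on UNIV f1"
    and "C2 \<phi>" and "C2 g" and "\<And>i. i \<in> {1..n1+n2} \<Longrightarrow> C2 (\<Phi> i)"
    and "umin \<noteq> \<infinity>" and "umax \<noteq> -\<infinity>"
    and "feasible T f0 f1 g n1 n2 \<Phi> umin umax u x"
    and first_order: "\<And>t. t \<in> {0..T} \<Longrightarrow> g (x t) = 0 \<Longrightarrow> row_deriv g (x t) \<bullet> f1 (x t) \<noteq> 0"
    and "0 < \<tau>" and "\<tau> < T"
    and "has_jump_at T u \<tau>"
    and "g (x \<tau>) = 0"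
  shows "\<forall>(\<beta>, \<Psi>, p, M) \<in> multipliers T f0 f1 \<phi> g n1 n2 \<Phi> umin umax u x.
           isCont (bv_primitive T M) \<tau>"
proof (clarify)
  fix \<beta> \<Psi> p M
  assume "(\<beta>, \<Psi>, p, M) \<in> multipliers T f0 f1 \<phi> g n1 n2 \<Phi> umin umax u x"
  then have p: "p \<in> BV T"
    and M: "finite_measure M" "sets M = sets (restrict_space borel {0..T})"
    and costate: "costate_eq T f0 f1 g u x p M"
    and min: "AE t in lebesgue_on {0..T}. control_min_cond umin umax (u t) (p t \<bullet> f1 (x t))"
    unfolding multipliers_def by auto
  note \<tau> = \<open>0 < \<tau>\<close> \<open>\<tau> < T\<close>
  obtain L where u: "u \<in> Linf T" and x: "L-lipschitz_on {0..T} x"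
    and der: "AE t in lebesgue_on {0..T}. (x has_vector_derivative (f0 (x t) + u t *\<^sub>R f1 (x t))) (at t)"
    and bounds: "AE t in lebesgue_on {0..T}. umin \<le> ereal (u t) \<and> ereal (u t) \<le> umax"
    and gx: "\<And>t. t \<in> {0..T} \<Longrightarrow> g (x t) \<le> 0"
    using \<open>feasible T f0 f1 g n1 n2 \<Phi> umin umax u x\<close> unfolding feasible_def W1inf_def by blast
  have xc: "continuous_on {0..T} x" using x by (rule lipschitz_on_continuous_on)
  have fc: "continuous_on UNIV f0" "continuous_on UNIV f1"
    using assms(3,5) lipschitz_on_continuous_on by blast+
  have gd: "g differentiable (at (x \<tau>))"
    using C2_imp_C1[OF \<open>C2 g\<close>] unfolding differentiable_def by metis
  obtain v l r where v: "AE t in lebesgue_on {0..T}. v t = u t"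
    "(v \<longlongrightarrow> l) (at_left \<tau>)" "(v \<longlongrightarrow> r) (at_right \<tau>)" and lr: "l \<noteq> r"
    using \<open>has_jump_at T u \<tau>\<close> unfolding has_jump_at_def by auto
  have ul: "(u \<longlongrightarrow> l) (ess_left \<tau>)"
    by (rule Lim_transform_eventually[OF tendsto_mono[OF ess_at_le v(2)] eventually_ess_at[OF v(1) \<tau>]])
  have ur: "(u \<longlongrightarrow> r) (ess_right \<tau>)"
    by (rule Lim_transform_eventually[OF tendsto_mono[OF ess_at_le v(3)] eventually_ess_at[OF v(1) \<tau>]])
  define G where "G = row_deriv g (x \<tau>)"
  define a where "a = G \<bullet> f1 (x \<tau>)"
  have a: "a \<noteq> 0"
    unfolding a_def G_def using first_order[of \<tau>] \<tau> \<open>g (x \<tau>) = 0\<close> by simp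
  have "G \<bullet> (f0 (x \<tau>) + r *\<^sub>R f1 (x \<tau>)) \<le> 0"
    unfolding G_def
    by (rule right_derivative_at_max[OF row_deriv_chain[OF gd state_one_sided_derivatives(1)[OF \<tau> x fc der ur]]])
      (use \<tau> gx \<open>g (x \<tau>) = 0\<close> in auto)
  moreover have "0 \<le> G \<bullet> (f0 (x \<tau>) + l *\<^sub>R f1 (x \<tau>))"
    unfolding G_def
    by (rule left_derivative_at_max[OF row_deriv_chain[OF gd state_one_sided_derivatives(2)[OF \<tau> x fc der ul]]])
      (use \<tau> gx \<open>g (x \<tau>) = 0\<close> in auto)
  ultimately have "(r - l) * a \<le> 0"
    by (simp add: a_def inner_add_right algebra_simps)
  then have jump_sign: "(r - l) * a < 0" using a lr by (simp add: order_less_le)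
  obtain pl pr where pl: "(p \<longlongrightarrow> pl) (ess_left \<tau>)" and pr: "(p \<longlongrightarrow> pr) (ess_right \<tau>)"
    and pjump: "pr - pl = - (measure M {\<tau>} *\<^sub>R G)"
    unfolding G_def
    using costate_jump[OF \<tau> p u xc \<open>C2 f0\<close> \<open>C2 f1\<close> \<open>C2 g\<close> M costate] by blast
  have "isCont x \<tau>" using continuous_on_interior[OF xc] \<tau> by simp
  then have "isCont (\<lambda>t. f1 (x t)) \<tau>"
    using fc by (auto intro: isCont_o2 simp: continuous_on_eq_continuous_at)
  then have f1x: "((\<lambda>t. f1 (x t)) \<longlongrightarrow> f1 (x \<tau>)) (ess_at \<tau> S)" for S
    unfolding isCont_def by (rule tendsto_mono[rotated]) (meson ess_at_le at_le order_trans subset_UNIV)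
  define hl where "hl = pl \<bullet> f1 (x \<tau>)"
  define hr where "hr = pr \<bullet> f1 (x \<tau>)"
  have H: "((\<lambda>t. p t \<bullet> f1 (x t)) \<longlongrightarrow> hl) (ess_left \<tau>)" "((\<lambda>t. p t \<bullet> f1 (x t)) \<longlongrightarrow> hr) (ess_right \<tau>)"
    unfolding hl_def hr_def by (intro tendsto_inner pl pr f1x)+
  have Hjump: "hr - hl = - (measure M {\<tau>} * a)"
    using arg_cong[OF pjump, of "\<lambda>z. z \<bullet> f1 (x \<tau>)"] by (simp add: hl_def hr_def a_def inner_diff_left)
  note ae = eventually_ess_at[OF bounds \<tau>] eventually_ess_at[OF min \<tau>]
  have "(r - l) * (hr - hl) \<le> 0"
  proof (cases "l < r")
    case True
    note control_min_cond_jump[OF ess_left_nontrivial ess_right_nontrivial ul ur H ae(1) ae(1) ae(2) ae(2) True]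
    then show ?thesis using True by (simp add: mult_le_0_iff)
  next
    case False
    then have "r < l" using lr by simp
    note control_min_cond_jump[OF ess_right_nontrivial ess_left_nontrivial ur ul H(2,1) ae(1) ae(1) ae(2) ae(2) this]
    then show ?thesis using \<open>r < l\<close> by (simp add: mult_le_0_iff)
  qed
  then have "0 \<le> measure M {\<tau>} * ((r - l) * a)"
    unfolding Hjump by (simp add: algebra_simps)
  then have "measure M {\<tau>} = 0"
    using mult_pos_neg[OF _ jump_sign, of "measure M {\<tau>}"] zero_less_measure_iff[of M "{\<tau>}"]
    by linarith
  then show "isCont (bv_primitive T M) \<tau>"
    by (rule isCont_bv_primitive[OF \<tau> M])
qed

end
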